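(* If $G$ is a $4$-$\chi_i$-lower-game-vertex-critical graph, then $\delta(G) \geq 3$.
   Context: All graphs are simple, undirected and finite; $\delta(G)$ is the minimum vertex degree of $G$. The indicated coloring game on a graph $G$ with color set $\{1,\ldots,k\}$ is played by Ann and Ben. In every round Ann selects a previously uncolored vertex and Ben colors it with any color from $\{1,\ldots,k\}$ that has not been used on its neighbors. Ann's goal is a proper coloring of the whole graph; Ben wins if at some point there is an uncolored vertex having all colors $1,\ldots,k$ in its neighborhood. The indicated chromatic number $\chi_i(G)$ is the minimum $k$ for which Ann has a winning strategy on $G$, no matter how Ben plays. For $x\in V(G)$, $G-x$ is the graph obtained from $G$ by deleting $x$ and all edges incident with $x$. A graph $G$ is $k$-$\chi_i$-lower-game-vertex-critical if $\chi_i(G)=k$ and $\chi_i(G-x)<\chi_i(G)$ for every $x\in V(G)$. *)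

theory Defs
  imports "Graph_Theory.Digraph"
begin

text \<open>
  A finite simple undirected graph is a \<open>graph\<close> of the library: a finite, loop-free digraph
  without parallel arcs whose arc relation is symmetric. An undirected edge is thus a pair of
  opposite arcs, \<open>u \<rightarrow>\<^bsub>G\<^esub> v\<close> is adjacency, and \<open>out_degree G v\<close> is the number of neighbours
  of \<open>v\<close>.
\<close>

definition min_degree :: "('a, 'b) pre_digraph \<Rightarrow> nat" where
  "min_degree G = Min (out_degree G ` verts G)"

definition available_colors ::
    "('a, 'b) pre_digraph \<Rightarrow> nat \<Rightarrow> ('a \<rightharpoonup> nat) \<Rightarrow> 'a \<Rightarrow> nat set" where
  "available_colors G k c v = {1..k} - {i. \<exists>u. u \<rightarrow>\<^bsub>G\<^esub> v \<and> c u = Some i}"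

definition uncolored :: "('a, 'b) pre_digraph \<Rightarrow> ('a \<rightharpoonup> nat) \<Rightarrow> 'a set" where
  "uncolored G c = verts G - dom c"

definition ben_wins_at :: "('a, 'b) pre_digraph \<Rightarrow> nat \<Rightarrow> ('a \<rightharpoonup> nat) \<Rightarrow> bool" where
  "ben_wins_at G k c \<longleftrightarrow> (\<exists>v \<in> uncolored G c. available_colors G k c v = {})"

text \<open>
  A history is the list of moves (selected vertex, colour given to it) made so far, the most
  recent one first; \<open>map_of\<close> turns it into the current partial colouring. A strategy of Ann
  maps histories to the vertex she selects next. The predicate below describes the histories
  that can arise when Ann follows \<open>\<sigma>\<close> and Ben plays arbitrarily.
\<close>

inductive play ::
    "('a, 'b) pre_digraph \<Rightarrow> nat \<Rightarrow> (('a \<times> nat) list \<Rightarrow> 'a) \<Rightarrow> ('a \<times> nat) list \<Rightarrow> bool"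
  for G k \<sigma> where
  start: "play G k \<sigma> []"
| round: "play G k \<sigma> ((\<sigma> h, i) # h)"
    if "play G k \<sigma> h"
      and "\<not> ben_wins_at G k (map_of h)"
      and "\<sigma> h \<in> uncolored G (map_of h)"
      and "i \<in> available_colors G k (map_of h) (\<sigma> h)"

text \<open>
  Ann never gets stuck: she always selects an uncoloured vertex while there is one, and Ben
  never wins. As every round colours a new vertex of the finite graph, all plays then end with
  the whole graph coloured, and properly so because Ben only uses available colours.
\<close>

definition winning_strategy ::
    "('a, 'b) pre_digraph \<Rightarrow> nat \<Rightarrow> (('a \<times> nat) list \<Rightarrow> 'a) \<Rightarrow> bool" where
  "winning_strategy G k \<sigma> \<longleftrightarrow>
    (\<forall>h. play G k \<sigma> h \<longrightarrow>
       \<not> ben_wins_at G k (map_of h) \<and>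
       (uncolored G (map_of h) \<noteq> {} \<longrightarrow> \<sigma> h \<in> uncolored G (map_of h)))"

definition indicated_chromatic_number :: "('a, 'b) pre_digraph \<Rightarrow> nat" where
  "indicated_chromatic_number G = (LEAST k. \<exists>\<sigma>. winning_strategy G k \<sigma>)"

definition lower_game_vertex_critical :: "nat \<Rightarrow> ('a, 'b) pre_digraph \<Rightarrow> bool" where
  "lower_game_vertex_critical k G \<longleftrightarrow>
    indicated_chromatic_number G = k \<and>
    (\<forall>x \<in> verts G.
       indicated_chromatic_number (pre_digraph.del_vert G x) < indicated_chromatic_number G)"

end

theory Submission
  imports Defs
begin

text \<open>
  Let \<open>x\<close> be a vertex with at most two neighbours. If Ann wins on \<open>G - x\<close> with three colours, she
  wins on \<open>G\<close> with three colours by selecting \<open>x\<close> last, contradicting \<open>\<chi>\<^sub>i(G) = 4\<close>. It is not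
  clear that winning with \<open>k\<close> colours implies winning with \<open>k + 1\<close>, so the case
  \<open>\<chi>\<^sub>i(G - x) \<le> 2\<close> needs a separate argument: then \<open>G - x\<close> is bipartite, and Ann wins
  on every bipartite graph with three colours as follows. She maintains a labelling \<open>X, Y\<close> of the
  two sides such that no uncoloured vertex of \<open>X\<close> sees both 1 and 2, and no uncoloured vertex of
  \<open>Y\<close> sees 3. She selects a vertex of \<open>X\<close> that sees 3 (it gets 1 or 2) or a vertex of \<open>Y\<close> that
  sees 1 and 2 (it gets 3). When there is no such vertex, the invariant holds for both labellings
  of the sides, so she selects any vertex and chooses the labelling after Ben's answer.
\<close>

section \<open>Invariants, strategies and the indicated chromatic number\<close>

text \<open>Although strategies may use the whole history, an invariant of the current colouring
  suffices: Ann selects, by choice, a vertex for which every answer of Ben preserves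
  \<open>P\<close>.\<close>

lemma winning_strategy_exI:
  assumes "P Map.empty"
    and "\<And>c. P c \<Longrightarrow> \<not> ben_wins_at G k c"
    and "\<And>c. P c \<Longrightarrow> uncolored G c \<noteq> {} \<Longrightarrow>
      \<exists>v \<in> uncolored G c. \<forall>i \<in> available_colors G k c v. P (c(v \<mapsto> i))"
  shows "\<exists>\<sigma>. winning_strategy G k \<sigma>"
proof -
  define good where "good c v \<longleftrightarrow> v \<in> uncolored G c \<and>
    (\<forall>i \<in> available_colors G k c v. P (c(v \<mapsto> i)))" for c v
  define \<sigma> where "\<sigma> h = (SOME v. good (map_of h) v)" for h
  have good: "good (map_of h) (\<sigma> h)" if "P (map_of h)" "uncolored G (map_of h) \<noteq> {}" for h
    unfolding \<sigma>_def by (rule someI_ex) (use assms(3)[OF that] in \<open>auto simp: good_def\<close>)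
  have inv: "P (map_of h)" if "play G k \<sigma> h" for h
    using that
  proof induction
    case start
    then show ?case using assms(1) by simp
  next
    case (round h i)
    then have "good (map_of h) (\<sigma> h)" by (intro good) auto
    with round.hyps have "P ((map_of h)(\<sigma> h \<mapsto> i))" by (simp add: good_def)
    then show ?case by (simp only: map_of.simps fst_conv snd_conv)
  qed
  have "winning_strategy G k \<sigma>"
    unfolding winning_strategy_def using inv good assms(2) by (auto simp: good_def)
  then show ?thesis by blast
qed

text \<open>A vertex sees at most one colour per vertex of the graph, so one extra colour always
  remains. This makes the \<open>LEAST\<close> in \<open>indicated_chromatic_number\<close>
  meaningful.\<close>

lemma winning_strategy_card_verts:
  assumes "wf_digraph G" "finite (verts G)"
  shows "\<exists>\<sigma>. winning_strategy G (Suc (card (verts G))) \<sigma>"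
proof (rule winning_strategy_exI[where P = "\<lambda>_. True"])
  fix c :: "'a \<rightharpoonup> nat"
  have "available_colors G (Suc (card (verts G))) c v \<noteq> {}" for v
  proof
    assume no_color: "available_colors G (Suc (card (verts G))) c v = {}"
    have "{1..Suc (card (verts G))} \<subseteq> (the \<circ> c) ` verts G"
    proof
      fix i assume "i \<in> {1..Suc (card (verts G))}"
      with no_color obtain u where u: "u \<rightarrow>\<^bsub>G\<^esub> v" "c u = Some i"
        by (auto simp: available_colors_def)
      then show "i \<in> (the \<circ> c) ` verts G"
        using wf_digraph.adj_in_verts(1)[OF assms(1) u(1)] by (force simp: image_iff)
    qed
    then have "card {1..Suc (card (verts G))} \<le> card (verts G)"
      using assms(2) by (meson card_image_le card_mono finite_imageI le_trans)
    then show False by simp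
  qed
  then show "\<not> ben_wins_at G (Suc (card (verts G))) c"
    by (simp add: ben_wins_at_def)
qed auto

lemma winning_strategy_indicated_chromatic_number:
  assumes "wf_digraph G" "finite (verts G)"
  shows "\<exists>\<sigma>. winning_strategy G (indicated_chromatic_number G) \<sigma>"
  unfolding indicated_chromatic_number_def
  by (rule LeastI) (rule winning_strategy_card_verts[OF assms])

lemma indicated_chromatic_number_le:
  "winning_strategy G k \<sigma> \<Longrightarrow> indicated_chromatic_number G \<le> k"
  unfolding indicated_chromatic_number_def by (auto intro: Least_le)

section \<open>Completed plays and two-colourability\<close>

text \<open>\<open>winning_strategy\<close> only speaks about the positions reached. A finished play
  exists because Ben always has a legal answer and each round removes one uncoloured vertex.\<close>

lemma winning_strategy_completes:
  assumes "winning_strategy G k \<sigma>" "finite (verts G)"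
  shows "\<exists>h. play G k \<sigma> h \<and> uncolored G (map_of h) = {}"
proof -
  have "\<exists>h'. play G k \<sigma> h' \<and> uncolored G (map_of h') = {}" if "play G k \<sigma> h" for h
    using that
  proof (induction "card (uncolored G (map_of h))" arbitrary: h rule: less_induct)
    case less
    show ?case
    proof (cases "uncolored G (map_of h) = {}")
      case False
      then have v: "\<sigma> h \<in> uncolored G (map_of h)" and nb: "\<not> ben_wins_at G k (map_of h)"
        using assms(1) less.prems by (auto simp: winning_strategy_def)
      then obtain i where i: "i \<in> available_colors G k (map_of h) (\<sigma> h)"
        by (auto simp: ben_wins_at_def)
      have "uncolored G (map_of ((\<sigma> h, i) # h)) = uncolored G (map_of h) - {\<sigma> h}"
        by (auto simp: uncolored_def)
      moreover have "finite (uncolored G (map_of h))"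
        using assms(2) by (simp add: uncolored_def)
      ultimately have
        "card (uncolored G (map_of ((\<sigma> h, i) # h))) < card (uncolored G (map_of h))"
        using v by (metis card_Diff1_less)
      then show ?thesis
        using less.hyps play.round[OF less.prems nb v i] by blast
    qed (use less.prems in blast)
  qed
  then show ?thesis using play.start by blast
qed

lemma play_proper:
  assumes "graph G" "play G k \<sigma> h"
  shows "map_of h u = Some i \<Longrightarrow> i \<in> {1..k}"
    and "u \<rightarrow>\<^bsub>G\<^esub> v \<Longrightarrow> map_of h u = Some i \<Longrightarrow> map_of h v \<noteq> Some i"
proof -
  interpret graph G by fact
  have "(\<forall>u i. map_of h u = Some i \<longrightarrow> i \<in> {1..k}) \<and>
    (\<forall>u v i. u \<rightarrow>\<^bsub>G\<^esub> v \<longrightarrow> map_of h u = Some i \<longrightarrow> map_of h v \<noteq> Some i)"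
    using assms(2)
  proof induction
    case (round h j)
    have "\<not> \<sigma> h \<rightarrow>\<^bsub>G\<^esub> \<sigma> h"
      using adj_not_same by blast
    moreover have "v \<rightarrow>\<^bsub>G\<^esub> u" if "u \<rightarrow>\<^bsub>G\<^esub> v" for u v
      using that arcs_ends_symmetric[OF sym_arcs] by blast
    ultimately show ?case
      using round by (auto simp: available_colors_def)
  qed simp
  then show "map_of h u = Some i \<Longrightarrow> i \<in> {1..k}"
    and "u \<rightarrow>\<^bsub>G\<^esub> v \<Longrightarrow> map_of h u = Some i \<Longrightarrow> map_of h v \<noteq> Some i"
    by blast+
qed

text \<open>The end of a completed play is a proper colouring with colours 1 and 2, and
  \<open>S\<close> is the colour class of 1.\<close>

lemma winning_strategy_two_bipartite:
  assumes "graph G" "winning_strategy G k \<sigma>" "k \<le> 2"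
  obtains S where "\<And>u v. u \<rightarrow>\<^bsub>G\<^esub> v \<Longrightarrow> u \<in> S \<longleftrightarrow> v \<notin> S"
proof -
  interpret graph G by fact
  obtain h where h: "play G k \<sigma> h" "uncolored G (map_of h) = {}"
    using winning_strategy_completes[OF assms(2)] by auto
  have col: "\<exists>i. map_of h v = Some i \<and> i \<in> {1, 2}" if "v \<in> verts G" for v
  proof -
    obtain i where i: "map_of h v = Some i"
      using h(2) \<open>v \<in> verts G\<close> by (auto simp: uncolored_def)
    moreover have "i \<in> {1..k}" by (rule play_proper(1)[OF assms(1) h(1) i])
    ultimately show ?thesis using assms(3) by auto
  qed
  show ?thesis
  proof (rule that)
    fix u v assume uv: "u \<rightarrow>\<^bsub>G\<^esub> v"
    then show "u \<in> {w. map_of h w = Some 1} \<longleftrightarrow> v \<notin> {w. map_of h w = Some 1}"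
      using col[of u] col[of v] play_proper(2)[OF assms(1) h(1) uv] adj_in_verts[OF uv] by auto
  qed
qed

section \<open>Three colours on a bipartite graph\<close>

lemma bipartite_winning_strategy:
  assumes bip: "\<And>u v. u \<rightarrow>\<^bsub>G\<^esub> v \<Longrightarrow> u \<in> S \<longleftrightarrow> v \<notin> S"
  shows "\<exists>\<sigma>. winning_strategy G 3 \<sigma>"
proof -
  define sees where "sees c v = {i. \<exists>u. u \<rightarrow>\<^bsub>G\<^esub> v \<and> c u = Some i}" for c :: "'a \<rightharpoonup> nat" and v
  define inv where "inv X c \<longleftrightarrow> (\<forall>v \<in> uncolored G c.
    (v \<in> X \<longrightarrow> 1 \<notin> sees c v \<or> 2 \<notin> sees c v) \<and> (v \<notin> X \<longrightarrow> 3 \<notin> sees c v))" for X c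
  have avail: "available_colors G 3 c v = {1, 2, 3} - sees c v" for c v
    by (auto simp: available_colors_def sees_def)
  have upd: "sees (c(v \<mapsto> i)) w = (if v \<rightarrow>\<^bsub>G\<^esub> w then insert i (sees c w) else sees c w)"
    "uncolored G (c(v \<mapsto> i)) = uncolored G c - {v}" if "v \<in> uncolored G c" for c v i w
    using that by (auto simp: sees_def uncolored_def)
  \<comment> \<open>Colours 1 and 2 placed in \<open>X\<close> are seen only outside
    \<open>X\<close>, where just 3 is harmful. A 3 placed outside \<open>X\<close> is seen only in
    \<open>X\<close>, where just the pair 1, 2 is harmful.\<close>
  have inv_upd: "inv X (c(v \<mapsto> i))"
    if "v \<in> uncolored G c" "inv X c" "X = S \<or> X = - S"
      "v \<in> X \<and> i \<in> {1, 2} \<or> v \<notin> X \<and> i = 3" for X c v i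
    unfolding inv_def
  proof
    fix w assume "w \<in> uncolored G (c(v \<mapsto> i))"
    then have w: "w \<in> uncolored G c" using upd(2)[OF that(1)] by simp
    have "v \<in> X \<longleftrightarrow> w \<notin> X" if "v \<rightarrow>\<^bsub>G\<^esub> w"
      using bip[OF that] \<open>X = S \<or> X = - S\<close> by blast
    then show "(w \<in> X \<longrightarrow> 1 \<notin> sees (c(v \<mapsto> i)) w \<or> 2 \<notin> sees (c(v \<mapsto> i)) w) \<and>
        (w \<notin> X \<longrightarrow> 3 \<notin> sees (c(v \<mapsto> i)) w)"
      using that(2,4) w unfolding upd(1)[OF that(1)] inv_def by auto
  qed
  let ?P = "\<lambda>c. inv S c \<or> inv (- S) c"
  show ?thesis
  proof (rule winning_strategy_exI[where P = ?P])
    show "?P Map.empty" by (simp add: inv_def sees_def)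
  next
    fix c assume "?P c"
    then show "\<not> ben_wins_at G 3 c"
      by (auto simp: ben_wins_at_def avail inv_def)
  next
    fix c assume "?P c" and unc: "uncolored G c \<noteq> {}"
    then obtain X where X: "X = S \<or> X = - S" "inv X c" by blast
    then have P: "?P c'" if "inv X c' \<or> inv (- X) c'" for c' using X(1) that by auto
    show "\<exists>v \<in> uncolored G c. \<forall>i \<in> available_colors G 3 c v. ?P (c(v \<mapsto> i))"
    \<comment> \<open>Vertices where Ben's answer is forced to suit the labelling
      \<open>X\<close>.\<close>
    proof (cases "\<exists>v \<in> uncolored G c. v \<in> X \<and> 3 \<in> sees c v \<or> v \<notin> X \<and> {1, 2} \<subseteq> sees c v")
      case True
      then obtain v where v: "v \<in> uncolored G c"
        "v \<in> X \<and> 3 \<in> sees c v \<or> v \<notin> X \<and> {1, 2} \<subseteq> sees c v" by blast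
      then have "inv X (c(v \<mapsto> i))" if "i \<in> available_colors G 3 c v" for i
        by (intro inv_upd) (use X that in \<open>auto simp: avail\<close>)
      then show ?thesis using v(1) P by blast
    next
      case False
      \<comment> \<open>The absence of forcing vertices is exactly the invariant for the swapped
        labelling.\<close>
      then have X': "inv (- X) c" using X(2) by (auto simp: inv_def)
      obtain v where v: "v \<in> uncolored G c" using unc by blast
      \<comment> \<open>After an answer 1 or 2 the side of \<open>v\<close> plays the role of
        \<open>X\<close>; after 3 the other side does.\<close>
      have "inv X (c(v \<mapsto> i)) \<or> inv (- X) (c(v \<mapsto> i))"
        if "i \<in> available_colors G 3 c v" for i
        using inv_upd[OF v X(2) X(1), of i] inv_upd[OF v X', of i] X(1) that
        by (auto simp: avail)
      then show ?thesis using v P by blast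
    qed
  qed
qed

section \<open>Restoring a vertex of low degree\<close>

lemma (in graph) graph_del_vert: "graph (del_vert x)"
proof -
  interpret D: fin_digraph "del_vert x" by (rule fin_digraph_del_vert)
  show ?thesis
  proof unfold_locales
    show "symmetric (del_vert x)"
      using sym_arcs unfolding symmetric_conv by (fastforce simp: del_vert_simps)
  qed (auto simp: del_vert_simps no_loops arc_to_ends_def no_multi_arcs)
qed

text \<open>Pigeonhole: by symmetry of the arcs, every colour seen by \<open>v\<close> sits at the
  head of an arc leaving \<open>v\<close>.\<close>

lemma (in graph) available_colors_low_degree:
  assumes "out_degree G v < k"
  shows "available_colors G k c v \<noteq> {}"
proof
  assume "available_colors G k c v = {}"
  have "{1..k} \<subseteq> (\<lambda>e. the (c (head G e))) ` out_arcs G v"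
  proof
    fix i assume "i \<in> {1..k}"
    with \<open>available_colors G k c v = {}\<close> obtain u where u: "u \<rightarrow>\<^bsub>G\<^esub> v" "c u = Some i"
      by (auto simp: available_colors_def)
    then have "v \<rightarrow>\<^bsub>G\<^esub> u" using arcs_ends_symmetric[OF sym_arcs] by blast
    then obtain e where "e \<in> out_arcs G v" "head G e = u"
      by (auto simp: arcs_ends_conv)
    then show "i \<in> (\<lambda>e. the (c (head G e))) ` out_arcs G v"
      using u(2) by force
  qed
  then have "card {1..k} \<le> out_degree G v"
    unfolding out_degree_def
    by (meson card_image_le card_mono finite_imageI finite_out_arcs le_trans)
  then show False using assms by simp
qed

lemma (in graph) winning_strategy_del_vert:
  assumes x: "x \<in> verts G" and win: "winning_strategy (del_vert x) k \<sigma>"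
    and deg: "out_degree G x < k"
  shows "\<exists>\<tau>. winning_strategy G k \<tau>"
proof -
  let ?H = "del_vert x"
  \<comment> \<open>The first disjunct covers the position after \<open>x\<close> is coloured, which
    no longer comes from a play on \<open>?H\<close>.\<close>
  let ?P = "\<lambda>c. uncolored G c = {} \<or> (\<exists>h. play ?H k \<sigma> h \<and> c = map_of h)"
  have dom: "x \<notin> dom (map_of h)" if "play ?H k \<sigma> h" for h
    using that by induction (auto simp: uncolored_def verts_del_vert)
  have unc: "uncolored G (map_of h) = insert x (uncolored ?H (map_of h))"
    if "play ?H k \<sigma> h" for h
    using x dom[OF that] by (auto simp: uncolored_def verts_del_vert)
  have adj: "u \<rightarrow>\<^bsub>?H\<^esub> v \<longleftrightarrow> u \<rightarrow>\<^bsub>G\<^esub> v" if "u \<noteq> x" "v \<noteq> x" for u v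
    using that by (auto simp: arcs_ends_conv del_vert_simps image_iff)
  \<comment> \<open>As long as \<open>x\<close> is uncoloured, it blocks no colour at its
    neighbours.\<close>
  have avail: "available_colors G k (map_of h) v = available_colors ?H k (map_of h) v"
    if "play ?H k \<sigma> h" "v \<noteq> x" for h v
  proof -
    have "u \<rightarrow>\<^bsub>?H\<^esub> v \<longleftrightarrow> u \<rightarrow>\<^bsub>G\<^esub> v" if "map_of h u = Some i" for u i
      using adj[of u v] \<open>v \<noteq> x\<close> dom[OF \<open>play ?H k \<sigma> h\<close>] that by auto
    then show ?thesis unfolding available_colors_def by blast
  qed
  have H: "\<not> ben_wins_at ?H k (map_of h)"
    "uncolored ?H (map_of h) \<noteq> {} \<Longrightarrow> \<sigma> h \<in> uncolored ?H (map_of h)"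
    if "play ?H k \<sigma> h" for h
    using win that by (auto simp: winning_strategy_def)
  have not_x: "v \<noteq> x" if "v \<in> uncolored ?H c" for v c
    using that by (auto simp: uncolored_def verts_del_vert)
  show ?thesis
  proof (rule winning_strategy_exI[where P = ?P])
    show "?P Map.empty"
      by (intro disjI2 exI[of _ "[]"]) (simp add: play.start)
  next
    fix c assume "?P c"
    then show "\<not> ben_wins_at G k c"
    proof
      assume "\<exists>h. play ?H k \<sigma> h \<and> c = map_of h"
      then obtain h where h: "play ?H k \<sigma> h" "c = map_of h" by blast
      show ?thesis
        using H(1)[OF h(1)] available_colors_low_degree[OF deg] avail[OF h(1)] not_x
        by (auto simp: ben_wins_at_def h(2) unc[OF h(1)])
    qed (simp add: ben_wins_at_def)
  next
    fix c assume "?P c" "uncolored G c \<noteq> {}"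
    then obtain h where h: "play ?H k \<sigma> h" "c = map_of h" by blast
    show "\<exists>v \<in> uncolored G c. \<forall>i \<in> available_colors G k c v. ?P (c(v \<mapsto> i))"
    proof (cases "uncolored ?H c = {}")
      case True
      \<comment> \<open>Only \<open>x\<close> is left, so any answer of Ben ends the game.\<close>
      then have "uncolored G (c(x \<mapsto> i)) = {}" for i
        using unc[OF h(1)] h(2) by (auto simp: uncolored_def)
      then show ?thesis using unc[OF h(1)] h(2) by auto
    next
      case False
      then have v: "\<sigma> h \<in> uncolored ?H (map_of h)" using H(2)[OF h(1)] h(2) by simp
      have "?P (c(\<sigma> h \<mapsto> i))" if "i \<in> available_colors G k c (\<sigma> h)" for i
      proof -
        have "play ?H k \<sigma> ((\<sigma> h, i) # h)"
          using h(1) H(1)[OF h(1)] v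
          by (rule play.round) (use that avail[OF h(1) not_x[OF v]] h(2) in simp)
        moreover have "c(\<sigma> h \<mapsto> i) = map_of ((\<sigma> h, i) # h)" using h(2) by simp
        ultimately show ?thesis by blast
      qed
      then show ?thesis using v unc[OF h(1)] h(2) by blast
    qed
  qed
qed

theorem corollary16:
  fixes G :: "('a, 'b) pre_digraph"
  assumes "graph G"
    and "lower_game_vertex_critical 4 G"
  shows "min_degree G \<ge> 3"
proof (rule ccontr)
  assume low: "\<not> min_degree G \<ge> 3"
  interpret graph G by fact
  have chi: "indicated_chromatic_number G = 4"
    and crit: "\<And>x. x \<in> verts G \<Longrightarrow> indicated_chromatic_number (del_vert x) < 4"
    using assms(2) by (auto simp: lower_game_vertex_critical_def)
  \<comment> \<open>Needed since \<open>min_degree\<close> takes a \<open>Min\<close>, which is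
    unspecified on the empty set; the empty graph is won with 0 colours.\<close>
  have "verts G \<noteq> {}"
  proof
    assume "verts G = {}"
    then have "winning_strategy G 0 \<sigma>" for \<sigma>
      by (auto simp: winning_strategy_def ben_wins_at_def uncolored_def)
    then show False using indicated_chromatic_number_le chi by fastforce
  qed
  then have "min_degree G \<in> out_degree G ` verts G"
    unfolding min_degree_def by (intro Min_in) auto
  then obtain x where x: "x \<in> verts G" "out_degree G x < 3" using low by auto
  let ?H = "del_vert x"
  have H: "graph ?H" by (rule graph_del_vert)
  interpret H: graph ?H by (rule H)
  obtain \<sigma> where \<sigma>: "winning_strategy ?H (indicated_chromatic_number ?H) \<sigma>"
    using winning_strategy_indicated_chromatic_number[OF H.wf_digraph_axioms] by auto
  have "\<exists>\<sigma>. winning_strategy ?H 3 \<sigma>"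
  proof (cases "indicated_chromatic_number ?H = 3")
    case True
    then show ?thesis using \<sigma> by auto
  next
    case False
    then have "indicated_chromatic_number ?H \<le> 2" using crit[OF x(1)] by simp
    then obtain S where "\<And>u v. u \<rightarrow>\<^bsub>?H\<^esub> v \<Longrightarrow> u \<in> S \<longleftrightarrow> v \<notin> S"
      using winning_strategy_two_bipartite[OF H \<sigma>] by blast
    then show ?thesis by (rule bipartite_winning_strategy)
  qed
  then obtain \<tau> where "winning_strategy G 3 \<tau>"
    using winning_strategy_del_vert[OF x(1) _ x(2)] by blast
  then show False using indicated_chromatic_number_le chi by fastforce
qed

end
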